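(* Let $1 \le k \le l$ be integers, let $I = \{1,\dots,l\}$, and let $y \in \mathbb{R}^l$ be ordered so that $y_1 \ge y_2 \ge \dots \ge y_l$. Let $\mathcal{C}$ be a nonempty closed convex subset of $\mathbb{R}^k_+ = \{x \in \mathbb{R}^k : x \ge 0\}$, and let $\mathcal{K}$ be the collection of all subsets $K \subseteq I$ with exactly $k$ elements. Consider the problem of minimizing jointly over $K \in \mathcal{K}$ and $z \in \mathbb{R}^l$ $$\min_{K \in \mathcal{K},\; z_K \in \mathcal{C},\; z_{I-K} = 0} \ \frac{1}{2}\|y - z\|^2 .$$ Then $K_{opt} = \{1,2,\dots,k\}$, i.e. the set of indices of the $k$ largest components of $y$, is an optimal choice of $K$: for every $K \in \mathcal{K}$, $$\min_{z_{K_{opt}} \in \mathcal{C},\; z_{I-K_{opt}} = 0} \frac{1}{2}\|y-z\|^2 \ \le\ \min_{z_{K} \in \mathcal{C},\; z_{I-K} = 0} \frac{1}{2}\|y-z\|^2 .$$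
   Context: $\|\cdot\|$ is the Euclidean norm. For a subset $K = \{i_1 < i_2 < \dots < i_k\} \subseteq I$, $z_K = (z_{i_1},\dots,z_{i_k}) \in \mathbb{R}^k$ is the subvector of $z$ indexed by $K$ (indices in increasing order), $I-K$ is the complement of $K$ in $I$, and $z_{I-K}$ is the corresponding subvector. Vector inequalities such as $x \ge 0$ are componentwise. *)

theory Defs
  imports "HOL-Analysis.Analysis"
begin

text \<open>
  Index sets are finite linearly ordered types, so that \<open>real ^ 'l\<close> carries the library's
  Euclidean norm, topology and convexity, while "indices in increasing order" still makes sense.
  Up to order isomorphism such a type with \<open>l\<close> elements is \<open>{1 < \<dots> < l}\<close>, and every \<open>l \<ge> 1\<close> occurs.
\<close>

text \<open>Positions are 0-based, matching list indexing: the least index has position 0.\<close>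

definition position :: "'n::{finite,linorder} \<Rightarrow> nat" where
  "position i = card {j. j < i}"

definition first_indices :: "nat \<Rightarrow> 'n::{finite,linorder} set" where
  "first_indices k = {i. position i < k}"

definition size_subsets :: "nat \<Rightarrow> 'n::finite set set" where
  "size_subsets k = {K. card K = k}"

text \<open>The subvector of \<open>z\<close> indexed by \<open>K\<close>; meaningful only when \<open>card K = CARD('k)\<close>.\<close>

definition subvec :: "'l set \<Rightarrow> (real, 'l::{finite,linorder}) vec
    \<Rightarrow> (real, 'k::{finite,linorder}) vec" where
  "subvec K z = (\<chi> j. z $ (sorted_list_of_set K ! position j))"

definition feasible :: "(real, 'k::{finite,linorder}) vec set \<Rightarrow> 'l set
    \<Rightarrow> (real, 'l::{finite,linorder}) vec set" where
  "feasible C K = {z. subvec K z \<in> C \<and> (\<forall>i. i \<notin> K \<longrightarrow> z $ i = 0)}"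

definition objective :: "real ^ 'l \<Rightarrow> real ^ 'l \<Rightarrow> real" where
  "objective y z = 1 / 2 * (norm (y - z))\<^sup>2"

end

theory Submission
  imports Defs
begin

text \<open>
  Let \<open>z\<close> be supported on \<open>K\<close>. Expanding the square gives
  \<open>\<parallel>y - z\<parallel>\<^sup>2 / 2 = \<parallel>y\<parallel>\<^sup>2 / 2 + \<parallel>z_K\<parallel>\<^sup>2 / 2 - y_K \<bullet> z_K\<close>,
  so with the entries \<open>x = z_K\<close> fixed, the choice of \<open>K\<close> matters only through \<open>y_K \<bullet> x\<close>
  (lemma \<open>objective_supported\<close>). The \<open>j\<close>-th smallest element of any index set has at least as many
  predecessors as the \<open>j\<close>-th index overall (lemma \<open>nth_first_indices_le\<close>), and \<open>y\<close> is
  nonincreasing, so \<open>y_K \<le> y_{K_opt}\<close> componentwise. As \<open>x \<ge> 0\<close>, moving the entries \<open>x\<close> from the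
  positions \<open>K\<close> to the positions \<open>K_opt\<close> keeps the vector feasible and does not increase the
  objective (lemma \<open>exists_better_on_first_indices\<close>). This settles the comparison of infima; they
  are attained because each feasible set is nonempty and closed in a Euclidean space.
\<close>

section \<open>Positions and increasing enumerations\<close>

lemma strict_mono_position: "strict_mono (position :: 'n::{finite,linorder} \<Rightarrow> nat)"
  unfolding strict_mono_def position_def
  by (intro allI impI psubset_card_mono) auto

lemma inj_position: "inj (position :: 'n::{finite,linorder} \<Rightarrow> nat)"
  by (rule strict_mono_imp_inj_on[OF strict_mono_position])

lemma bij_betw_position:
  "bij_betw (position :: 'n::{finite,linorder} \<Rightarrow> nat) UNIV {..<CARD('n)}"
proof -
  have "position i < CARD('n)" for i :: 'n
    unfolding position_def by (rule psubset_card_mono) auto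
  then have "range (position :: 'n \<Rightarrow> nat) = {..<CARD('n)}"
    by (intro card_subset_eq) (auto simp: card_image[OF inj_position])
  then show ?thesis
    by (simp add: bij_betw_def inj_position)
qed

lemma card_first_indices:
  assumes "k \<le> CARD('n)"
  shows "card (first_indices k :: 'n::{finite,linorder} set) = k"
proof -
  have "position ` (first_indices k :: 'n set) = range (position :: 'n \<Rightarrow> nat) \<inter> {..<k}"
    by (auto simp: first_indices_def)
  also have "\<dots> = {..<k}"
    using bij_betw_position[where 'n = 'n] assms by (auto simp: bij_betw_def)
  finally have "position ` (first_indices k :: 'n set) = {..<k}" .
  then show ?thesis
    by (metis card_image card_lessThan inj_on_subset[OF inj_position subset_UNIV])
qed

lemma bij_betw_nth_position:
  fixes K :: "'l::{finite,linorder} set"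
  assumes "card K = CARD('k)"
  shows "bij_betw (\<lambda>j::'k::{finite,linorder}. sorted_list_of_set K ! position j) UNIV K"
proof -
  have "bij_betw ((!) (sorted_list_of_set K)) {..<CARD('k)} K"
    using assms by (intro bij_betw_nth) auto
  from bij_betw_trans[OF bij_betw_position this] show ?thesis
    by (simp add: comp_def)
qed

lemma card_less_nth_sorted_list_of_set:
  fixes K :: "'l::linorder set"
  assumes "finite K" "n < card K"
  shows "card {j \<in> K. j < sorted_list_of_set K ! n} = n"
proof -
  let ?xs = "sorted_list_of_set K"
  have lt: "?xs ! a < ?xs ! b" if "a < b" "b < card K" for a b
    using that sorted_wrt_nth_less[OF strict_sorted_list_of_set[of K]] by simp
  have less_iff: "?xs ! a < ?xs ! b \<longleftrightarrow> a < b" if "a < card K" "b < card K" for a b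
    using that lt[of a b] lt[of b a] by (cases a b rule: linorder_cases) auto
  have "K = (!) ?xs ` {..<card K}"
    using assms(1) bij_betw_nth[of ?xs "{..<card K}" K] by (simp add: bij_betw_def)
  then have "{j \<in> K. j < ?xs ! n} = {j \<in> (!) ?xs ` {..<card K}. j < ?xs ! n}"
    by (rule arg_cong[where f = "\<lambda>A. {j \<in> A. j < ?xs ! n}"])
  also have "\<dots> = (!) ?xs ` {..<n}"
    using less_iff assms(2) by auto
  finally have "{j \<in> K. j < ?xs ! n} = (!) ?xs ` {..<n}" .
  moreover have "inj_on ((!) ?xs) {..<n}"
    using assms by (intro inj_on_nth) auto
  ultimately show ?thesis
    by (simp add: card_image)
qed

text \<open>
  Both indices are compared through their number of predecessors: a downward closed set contains
  all predecessors of its elements, whereas a general \<open>K\<close> may miss some of them.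
\<close>

lemma nth_first_indices_le:
  fixes K :: "'l::{finite,linorder} set"
  assumes "n < card K"
  shows "sorted_list_of_set (first_indices (card K)) ! n \<le> sorted_list_of_set K ! n"
proof -
  let ?F = "first_indices (card K) :: 'l set"
  have card_F: "card ?F = card K"
    by (intro card_first_indices card_mono) auto
  define i where "i = sorted_list_of_set ?F ! n"
  have "i \<in> ?F"
    using assms card_F nth_mem[of n "sorted_list_of_set ?F"] by (simp add: i_def)
  then have "j \<in> ?F" if "j < i" for j
    using that strict_monoD[OF strict_mono_position that] by (simp add: first_indices_def)
  then have "{j. j < i} = {j \<in> ?F. j < i}"
    by auto
  then have "position i = n"
    using assms card_F card_less_nth_sorted_list_of_set[of ?F n]
    by (simp add: position_def i_def)
  also have "n = card {j \<in> K. j < sorted_list_of_set K ! n}"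
    using assms by (simp add: card_less_nth_sorted_list_of_set)
  also have "\<dots> \<le> position (sorted_list_of_set K ! n)"
    unfolding position_def by (rule card_mono) auto
  finally show ?thesis
    by (simp add: strict_mono_less_eq[OF strict_mono_position] i_def)
qed

section \<open>Vectors supported on an index set\<close>

lemma inner_supported:
  fixes y z :: "(real, 'l::{finite,linorder}) vec"
  assumes "card K = CARD('k)" and "\<And>i. i \<notin> K \<Longrightarrow> z $ i = 0"
  shows "y \<bullet> z = subvec K y \<bullet> (subvec K z :: (real, 'k::{finite,linorder}) vec)"
proof -
  have "y \<bullet> z = (\<Sum>i\<in>K. y $ i * z $ i)"
    unfolding inner_vec_def inner_real_def
    using assms(2) by (intro sum.mono_neutral_right) auto
  also have "\<dots> = subvec K y \<bullet> (subvec K z :: (real, 'k) vec)"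
    unfolding inner_vec_def subvec_def
    by (simp add: sum.reindex_bij_betw[OF bij_betw_nth_position[OF assms(1)], symmetric])
  finally show ?thesis .
qed

text \<open>
  The first two terms depend on \<open>z\<close> only through its entries, so comparing two supports that carry
  the same entries reduces to comparing the inner products.
\<close>

lemma objective_supported:
  fixes y z :: "(real, 'l::{finite,linorder}) vec"
  assumes "card K = CARD('k)" and "\<And>i. i \<notin> K \<Longrightarrow> z $ i = 0"
  shows "objective y z = (norm y)\<^sup>2 / 2
    + (norm (subvec K z :: (real, 'k::{finite,linorder}) vec))\<^sup>2 / 2
    - subvec K y \<bullet> (subvec K z :: (real, 'k) vec)"
proof -
  have "objective y z = (norm y)\<^sup>2 / 2 + z \<bullet> z / 2 - y \<bullet> z"
    by (simp add: objective_def power2_norm_eq_inner inner_diff inner_commute field_simps)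
  then show ?thesis
    by (simp add: inner_supported[where 'k = 'k and K = K and z = z, OF assms]
        power2_norm_eq_inner)
qed

lemma subvec_surj_supported:
  fixes K :: "'l::{finite,linorder} set" and x :: "(real, 'k::{finite,linorder}) vec"
  assumes "card K = CARD('k)"
  obtains z where "subvec K z = x" "\<And>i. i \<notin> K \<Longrightarrow> z $ i = 0"
proof -
  let ?e = "\<lambda>j::'k. sorted_list_of_set K ! position j"
  let ?z = "\<chi> i. if i \<in> K then x $ inv ?e i else 0"
  have bij: "bij_betw ?e UNIV K"
    by (rule bij_betw_nth_position[OF assms])
  then have "?e j \<in> K" "inv ?e (?e j) = j" for j
    using inv_f_f[of ?e j] by (auto simp: bij_betw_def)
  then have "subvec K ?z = x"
    by (simp add: subvec_def vec_eq_iff)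
  then show ?thesis
    by (rule that) simp
qed

lemma closed_feasible:
  fixes C :: "(real, 'k::{finite,linorder}) vec set"
  assumes "closed C"
  shows "closed (feasible C (K :: 'l::{finite,linorder} set))"
proof -
  have "continuous_on UNIV (subvec K :: (real, 'l) vec \<Rightarrow> (real, 'k) vec)"
    unfolding subvec_def by (intro continuous_intros)
  then have "closed (subvec K -` C :: (real, 'l) vec set)"
    using assms by (simp add: closed_vimage)
  moreover have "closed {z :: (real, 'l) vec. \<forall>i. i \<notin> K \<longrightarrow> z $ i = 0}"
    by (intro closed_Collect_all closed_Collect_imp closed_Collect_eq open_Collect_const
        continuous_intros)
  moreover have "feasible C K = subvec K -` C \<inter> {z. \<forall>i. i \<notin> K \<longrightarrow> z $ i = 0}"
    by (auto simp: feasible_def)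
  ultimately show ?thesis
    by auto
qed

lemma feasible_nonempty:
  fixes C :: "(real, 'k::{finite,linorder}) vec set"
  assumes "C \<noteq> {}" "card K = CARD('k)"
  shows "feasible C K \<noteq> {}"
proof -
  from assms(1) obtain x where "x \<in> C" by auto
  obtain z where "subvec K z = x" "\<And>i. i \<notin> K \<Longrightarrow> z $ i = 0"
    using subvec_surj_supported[OF assms(2)] by blast
  with \<open>x \<in> C\<close> have "z \<in> feasible C K"
    by (simp add: feasible_def)
  then show ?thesis by auto
qed

section \<open>Minimizers and their comparison\<close>

lemma objective_attains_min:
  fixes S :: "(real ^ 'l) set"
  assumes "closed S" "S \<noteq> {}"
  shows "\<exists>z. is_arg_min (objective y) (\<lambda>z. z \<in> S) z"
proof -
  obtain z where "z \<in> S" "\<And>w. w \<in> S \<Longrightarrow> dist y z \<le> dist y w"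
    using distance_attains_inf[OF assms] by blast
  then show ?thesis
    by (auto simp: is_arg_min_linorder objective_def dist_norm intro!: exI[of _ z] power_mono)
qed

text \<open>
  The witness carries the entries of \<open>z\<close>, in the same order, on the first indices. This keeps
  membership in an arbitrary \<open>C\<close>, and by nonnegativity of the entries the inner product
  with \<open>y\<close> can only grow, since each entry meets a component of \<open>y\<close> that is at least as large.
\<close>

lemma exists_better_on_first_indices:
  fixes y :: "(real, 'l::{finite,linorder}) vec" and C :: "(real, 'k::{finite,linorder}) vec set"
  assumes mono: "\<And>i j. i \<le> j \<Longrightarrow> y $ j \<le> y $ i"
    and nonneg: "C \<subseteq> {x. 0 \<le> x}"
    and K: "card K = CARD('k)" and z: "z \<in> feasible C K"
  shows "\<exists>z' \<in> feasible C (first_indices CARD('k)). objective y z' \<le> objective y z"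
proof -
  let ?F = "first_indices CARD('k) :: 'l set"
  have F: "card ?F = CARD('k)"
    unfolding K[symmetric] by (intro card_first_indices card_mono) auto
  define x :: "(real, 'k) vec" where "x = subvec K z"
  have x: "x \<in> C" and z0: "\<And>i. i \<notin> K \<Longrightarrow> z $ i = 0"
    using z by (auto simp: feasible_def x_def)
  obtain z' where z': "subvec ?F z' = x" "\<And>i. i \<notin> ?F \<Longrightarrow> z' $ i = 0"
    using subvec_surj_supported[OF F] by blast
  have "position j < card K" for j :: 'k
    using bij_betw_position[where 'n = 'k] K by (auto simp: bij_betw_def)
  then have "(subvec K y :: (real, 'k) vec) $ j \<le> subvec ?F y $ j" for j
    using nth_first_indices_le[of "position j" K] K by (simp add: subvec_def mono)
  moreover have "0 \<le> x $ j" for j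
    using x nonneg by (auto simp: less_eq_vec_def)
  ultimately have "subvec K y \<bullet> x \<le> subvec ?F y \<bullet> x"
    unfolding inner_vec_def inner_real_def by (intro sum_mono mult_right_mono) auto
  then have "objective y z' \<le> objective y z"
    using objective_supported[where 'k = 'k and y = y, OF K z0]
      objective_supported[where 'k = 'k and y = y, OF F z'(2)]
    by (simp add: z'(1) x_def)
  moreover have "z' \<in> feasible C ?F"
    using z' x by (simp add: feasible_def)
  ultimately show ?thesis by blast
qed

theorem lemma1:
  fixes y :: "(real, 'l::{finite,linorder}) vec"
    and C :: "(real, 'k::{finite,linorder}) vec set"
  assumes "CARD('k) \<le> CARD('l)"
    and "\<And>i j. i \<le> j \<Longrightarrow> y $ j \<le> y $ i"
    and "C \<noteq> {}" and "closed C" and "convex C"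
    and "C \<subseteq> {x. 0 \<le> x}"
  shows "(\<forall>K \<in> size_subsets CARD('k). \<exists>z. is_arg_min (objective y) (\<lambda>z. z \<in> feasible C K) z)
    \<and> (\<exists>z. is_arg_min (\<lambda>(K, z). objective y z)
          (\<lambda>(K, z). K \<in> size_subsets CARD('k) \<and> z \<in> feasible C K)
          (first_indices CARD('k), z))
    \<and> (\<forall>K \<in> size_subsets CARD('k).
          (INF z \<in> feasible C (first_indices CARD('k)). objective y z)
            \<le> (INF z \<in> feasible C K. objective y z))"
proof -
  let ?F = "first_indices CARD('k) :: 'l set"
  have F: "card ?F = CARD('k)"
    by (rule card_first_indices[OF assms(1)])
  have min: "\<exists>z. is_arg_min (objective y) (\<lambda>z. z \<in> feasible C K) z" if "card K = CARD('k)" for K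
    using objective_attains_min closed_feasible[OF assms(4)] feasible_nonempty[OF assms(3) that]
    by blast
  have better: "\<exists>z' \<in> feasible C ?F. objective y z' \<le> objective y z"
    if "card K = CARD('k)" "z \<in> feasible C K" for K z
    using exists_better_on_first_indices[OF assms(2,6) that] .
  obtain z0 where z0: "is_arg_min (objective y) (\<lambda>z. z \<in> feasible C ?F) z0"
    using min[OF F] by blast
  then have "is_arg_min (\<lambda>(K, z). objective y z)
      (\<lambda>(K, z). K \<in> size_subsets CARD('k) \<and> z \<in> feasible C K) (?F, z0)"
    using F better by (fastforce simp: is_arg_min_linorder size_subsets_def)
  moreover have "(INF z \<in> feasible C ?F. objective y z) \<le> (INF z \<in> feasible C K. objective y z)"
    if "card K = CARD('k)" for K
  proof (rule cINF_mono)
    show "feasible C K \<noteq> {}"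
      by (rule feasible_nonempty[OF assms(3) that])
    show "bdd_below (objective y ` feasible C ?F)"
      by (rule bdd_belowI[of _ 0]) (auto simp: objective_def)
  qed (use better that in blast)
  ultimately show ?thesis
    using min by (auto simp: size_subsets_def)
qed

end
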